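(* Let $\tilde v,\tilde w$ be signed permutation matrices of size $n$ with $\tilde v^2=\tilde w^2=1$, such that $\tilde v\in\overline{\mathfrak B_{\tilde w}}$ and $\operatorname{cd}_{\tilde v}=\operatorname{cd}_{\tilde w}-1$. Let $v,w$ be the underlying permutations and let $(i,j)$, $i<j$, be the (unique) suitable rise of $v$ such that $w=v\cdot \mathrm{co}_{(i,j)}(v)$. Then $\tilde w=\tilde v\cdot \mathrm{co}_{(i,j)}(v)\cdot D$ for a diagonal matrix $D$ with entries $\pm1$, and the signed permutation $\tilde\sigma:=\mathrm{co}_{(i,j)}(v)\cdot D=\tilde v\tilde w$ satisfies $\tilde\sigma(e_k)=e_k$ for all $k\notin\{i,j,v(i),v(j)\}$ and, for some signs $\alpha,\beta,\gamma\in\{\pm1\}$, is given on the remaining basis vectors according to the type of the rise $(i,j)$ of $v$ as follows. (1) $f\!f$: $\tilde\sigma(e_i)=\alpha e_j$, $\tilde\sigma(e_j)=-\alpha e_i$. (2) $fe$: $\tilde\sigma(e_i)=\beta e_j$, $\tilde\sigma(e_j)=\alpha e_{v(j)}$, $\tilde\sigma(e_{v(j)})=\alpha\beta e_i$. (3) $ef$: $\tilde\sigma(e_i)=\alpha e_j$, $\tilde\sigma(e_j)=\beta e_{v(i)}$, $\tilde\sigma(e_{v(i)})=\alpha\beta e_i$. (4) $ee$ non-crossing: $\tilde\sigma(e_i)=\beta e_j$, $\tilde\sigma(e_j)=-\beta e_i$, $\tilde\sigma(e_{v(i)})=\alpha e_{v(j)}$, $\tilde\sigma(e_{v(j)})=-\alpha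 e_{v(i)}$. (5) $ee$ crossing: $\tilde\sigma(e_i)=\gamma e_j$, $\tilde\sigma(e_j)=\alpha e_{v(j)}$, $\tilde\sigma(e_{v(j)})=\beta e_{v(i)}$, $\tilde\sigma(e_{v(i)})=-\alpha\beta\gamma e_i$. (6) $ed$: $\tilde\sigma(e_i)=\alpha e_j$, $\tilde\sigma(e_j)=-\alpha e_i$, $\tilde\sigma(e_{v(i)})=\beta e_{v(j)}$, $\tilde\sigma(e_{v(j)})=-\beta e_{v(i)}$.
   Context: A signed permutation matrix $\tilde w$ of size $n$ acts by $\tilde w(e_i)=\epsilon_ie_{w(i)}$ with $\epsilon_i\in\{\pm1\}$ and underlying permutation $w$. $B^+$ is the group of real invertible upper triangular $n\times n$ matrices with positive diagonal. For a signed involution $\tilde w$ (i.e. $\tilde w^2=1$) with $\operatorname{Tr}\tilde w=n-2k$ let $G_k=\{g\in O(n):g^2=1,\operatorname{Tr}g=n-2k\}$ and $\mathfrak B_{\tilde w}=G_k\cap B^+\tilde wB^+$; the closure is taken in $G_k$. The cell dimension $\operatorname{cd}_{\tilde w}=\operatorname{cd}_w$ is the number of equivalence classes of inversions $\{(i,j): i<j,\ w(i)>w(j)\}$ under $(i,j)\sim(w(j),w(i))$. Let $v$ be an involution. A rise of $v$ is a pair $(i,j)$ with $i<j$, $v(i)<v(j)$; it is free if there is no $k$ with $i<k<j$ and $v(i)<v(k)<v(j)$. The type of an index $i$ is $d$ if $v(i)<i$, $f$ if $v(i)=i$, $e$ if $v(i)>i$; the type of a rise $(i,j)$ is the pair of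 types of $i$ and $j$. A rise is suitable if it is free and of type $f\!f$, $fe$, $ef$, $ee$ or $ed$. A rise of type $ee$ is crossing if $i<v(i)<j<v(j)$ and non-crossing if $i<j<v(i)<v(j)$. For a suitable rise, the covering operation $\mathrm{co}_{(i,j)}(v)$ is the following permutation in cycle notation (where $(a,b,c)$ means $a\mapsto b\mapsto c\mapsto a$): $f\!f$: $(i,j)$; $fe$: $(i,j,v(j))$; $ef$: $(i,j,v(i))$; $ee$ non-crossing: $(i,j)(v(i),v(j))$; $ee$ crossing: $(i,j,v(j),v(i))$; $ed$: $(i,j)(v(i),v(j))$. Products of permutations are compositions, $w(x)=v(\mathrm{co}_{(i,j)}(v)(x))$. By a theorem of Incitti, for involutions $v,w$ with $\operatorname{cd}_v=\operatorname{cd}_w-1$ one has $v<w$ in Bruhat order if and only if $w=v\cdot\mathrm{co}_{(i,j)}(v)$ for a suitable rise $(i,j)$ of $v$, and $(i,j)$ is then unique. *)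

theory Defs
  imports "HOL-Analysis.Analysis" "HOL-Combinatorics.Cycles"
begin

text \<open>
  Matrices of size \<open>n\<close> are indexed by an arbitrary finite linearly ordered type \<open>'n\<close>,
  with \<open>n = CARD('n)\<close>; the order is what gives meaning to upper triangularity, inversions and rises.
\<close>

abbreviation std_basis :: "'n::finite \<Rightarrow> real^'n" where
  "std_basis i \<equiv> axis i 1"

text \<open>\<open>signed_perm_matrix A w\<close>: \<open>A\<close> is a signed permutation matrix with underlying permutation \<open>w\<close>.\<close>

definition signed_perm_matrix :: "real^'n^'n \<Rightarrow> ('n::finite \<Rightarrow> 'n) \<Rightarrow> bool" where
  "signed_perm_matrix A w \<longleftrightarrow>
     bij w \<and> (\<exists>\<epsilon>. \<forall>i. \<epsilon> i \<in> {1, -1} \<and> A *v std_basis i = \<epsilon> i *\<^sub>R std_basis (w i))"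

definition perm_matrix :: "('n::finite \<Rightarrow> 'n) \<Rightarrow> real^'n^'n" where
  "perm_matrix p = (\<chi> r c. if r = p c then 1 else 0)"

lemma perm_matrix_std_basis: "perm_matrix p *v std_basis i = std_basis (p i)"
  unfolding matrix_vector_mult_basis by (simp add: vec_eq_iff column_def perm_matrix_def axis_def)

definition sign_diagonal_matrix :: "real^'n^'n \<Rightarrow> bool" where
  "sign_diagonal_matrix D \<longleftrightarrow>
     (\<forall>r c. r \<noteq> c \<longrightarrow> D $ r $ c = 0) \<and> (\<forall>r. D $ r $ r \<in> {1, -1})"

definition borel_pos :: "(real^'n::{finite,linorder}^'n::{finite,linorder}) set" where
  "borel_pos = {b. invertible b \<and> (\<forall>r c. c < r \<longrightarrow> b $ r $ c = 0) \<and> (\<forall>r. 0 < b $ r $ r)}"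

definition orth_involutions :: "nat \<Rightarrow> (real^'n^'n) set" where
  "orth_involutions k =
     {g. orthogonal_matrix g \<and> g ** g = mat 1 \<and> trace g = real CARD('n) - 2 * real k}"

text \<open>The cell \<open>\<BB>\<close> of \<open>A\<close>; here \<open>k\<close> is meant to satisfy \<open>trace A = n - 2 k\<close>.\<close>

definition bruhat_cell ::
  "nat \<Rightarrow> real^'n::{finite,linorder}^'n::{finite,linorder}
    \<Rightarrow> (real^'n::{finite,linorder}^'n::{finite,linorder}) set" where
  "bruhat_cell k A =
     orth_involutions k \<inter> {b ** A ** b' | b b'. b \<in> borel_pos \<and> b' \<in> borel_pos}"

definition inversions :: "('n::linorder \<Rightarrow> 'n) \<Rightarrow> ('n \<times> 'n) set" where
  "inversions w = {(i, j). i < j \<and> w i > w j}"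

text \<open>If \<open>w\<close> is an involution, so is \<open>(i, j) \<mapsto> (w j, w i)\<close> on inversions, and
  \<open>inversion_equiv w\<close> is an equivalence relation.\<close>

definition inversion_equiv :: "('n::linorder \<Rightarrow> 'n) \<Rightarrow> (('n \<times> 'n) \<times> ('n \<times> 'n)) set" where
  "inversion_equiv w =
     {(p, q). p \<in> inversions w \<and> q \<in> inversions w \<and> (q = p \<or> q = (w (snd p), w (fst p)))}"

lemma equiv_inversion_equiv:
  assumes "w \<circ> w = id"
  shows "equiv (inversions w) (inversion_equiv w)"
proof -
  have "w (w x) = x" for x
    using assms by (metis comp_apply id_apply)
  then show ?thesis
    by (auto simp: equiv_def refl_on_def sym_def trans_def inversion_equiv_def)
qed

definition cell_dim :: "('n::{finite,linorder} \<Rightarrow> 'n) \<Rightarrow> nat" where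
  "cell_dim w = card (inversions w // inversion_equiv w)"

datatype index_type = Ty_d | Ty_f | Ty_e

definition index_type :: "('n::linorder \<Rightarrow> 'n) \<Rightarrow> 'n \<Rightarrow> index_type" where
  "index_type v i = (if v i < i then Ty_d else if v i = i then Ty_f else Ty_e)"

definition rise_type :: "('n::linorder \<Rightarrow> 'n) \<Rightarrow> 'n \<Rightarrow> 'n \<Rightarrow> index_type \<times> index_type" where
  "rise_type v i j = (index_type v i, index_type v j)"

definition is_rise :: "('n::linorder \<Rightarrow> 'n) \<Rightarrow> 'n \<Rightarrow> 'n \<Rightarrow> bool" where
  "is_rise v i j \<longleftrightarrow> i < j \<and> v i < v j"

definition free_rise :: "('n::linorder \<Rightarrow> 'n) \<Rightarrow> 'n \<Rightarrow> 'n \<Rightarrow> bool" where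
  "free_rise v i j \<longleftrightarrow>
     is_rise v i j \<and> \<not> (\<exists>k. i < k \<and> k < j \<and> v i < v k \<and> v k < v j)"

definition suitable_rise :: "('n::linorder \<Rightarrow> 'n) \<Rightarrow> 'n \<Rightarrow> 'n \<Rightarrow> bool" where
  "suitable_rise v i j \<longleftrightarrow>
     free_rise v i j \<and>
     rise_type v i j \<in> {(Ty_f, Ty_f), (Ty_f, Ty_e), (Ty_e, Ty_f), (Ty_e, Ty_e), (Ty_e, Ty_d)}"

definition crossing :: "('n::linorder \<Rightarrow> 'n) \<Rightarrow> 'n \<Rightarrow> 'n \<Rightarrow> bool" where
  "crossing v i j \<longleftrightarrow> i < v i \<and> v i < j \<and> j < v j"

definition non_crossing :: "('n::linorder \<Rightarrow> 'n) \<Rightarrow> 'n \<Rightarrow> 'n \<Rightarrow> bool" where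
  "non_crossing v i j \<longleftrightarrow> i < j \<and> j < v i \<and> v i < v j"

text \<open>\<open>cycle_of_list [a, b, c]\<close> maps \<open>a \<mapsto> b \<mapsto> c \<mapsto> a\<close>. The value \<open>id\<close> is a dummy
  that is never taken on a suitable rise of an involution.\<close>

definition covering_op :: "('n::linorder \<Rightarrow> 'n) \<Rightarrow> 'n \<Rightarrow> 'n \<Rightarrow> ('n \<Rightarrow> 'n)" where
  "covering_op v i j =
     (if rise_type v i j = (Ty_f, Ty_f) then cycle_of_list [i, j]
      else if rise_type v i j = (Ty_f, Ty_e) then cycle_of_list [i, j, v j]
      else if rise_type v i j = (Ty_e, Ty_f) then cycle_of_list [i, j, v i]
      else if rise_type v i j = (Ty_e, Ty_e) \<and> non_crossing v i j
        then cycle_of_list [i, j] \<circ> cycle_of_list [v i, v j]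
      else if rise_type v i j = (Ty_e, Ty_e) \<and> crossing v i j
        then cycle_of_list [i, j, v j, v i]
      else if rise_type v i j = (Ty_e, Ty_d)
        then cycle_of_list [i, j] \<circ> cycle_of_list [v i, v j]
      else id)"

end

theory Submission
  imports Defs
begin

text \<open>
  Write \<open>\<epsilon>\<close>, \<open>\<delta>\<close> for the signs of \<open>vt\<close>, \<open>wt\<close>, and let \<open>g = b wt b'\<close> be a point of the cell close to
  \<open>vt\<close>. The vectors supported on the indices \<open>\<le> l\<close> whose image under \<open>g\<close> is supported on the
  indices \<open>\<le> w l\<close> are known explicitly, and the coordinate \<open>w l\<close> of the image has sign \<open>\<delta> l\<close>. If
  \<open>v\<close> and \<open>w\<close> have equally many points in the rectangle below \<open>(l, w l)\<close>, a dimension count allows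
  us to clear all other coordinates of the image that survive in the limit, so that the vector
  tends to \<open>e\<^sub>l\<close>. For \<open>l\<close> outside \<open>{i, j, v i, v j}\<close> this yields \<open>\<epsilon> l = \<delta> l\<close>. For the types
  \<open>ff\<close>, non-crossing \<open>ee\<close> and \<open>ed\<close>, pairing such a vector near \<open>e\<^sub>i\<close> with its order-reversed
  analogue near \<open>e\<^sub>j\<close> and using that \<open>g\<close> is orthogonal gives \<open>\<delta> i \<delta> j = - \<epsilon> i \<epsilon> j\<close>. For the types
  \<open>fe\<close>, \<open>ef\<close> and crossing \<open>ee\<close> the remaining relation is the equality of traces.
\<close>

section \<open>Signed permutation matrices\<close>

text \<open>Making the sign function a parameter lets the signs of \<open>vt\<close> and
  \<open>wt\<close> be compared index by index.\<close>

definition signed_perm_with :: "real^'n^'n \<Rightarrow> ('n::finite \<Rightarrow> 'n) \<Rightarrow> ('n \<Rightarrow> real) \<Rightarrow> bool" where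
  "signed_perm_with A w \<epsilon> \<longleftrightarrow>
     bij w \<and> (\<forall>i. \<epsilon> i \<in> {1, -1} \<and> A *v std_basis i = \<epsilon> i *\<^sub>R std_basis (w i))"

lemma signed_perm_matrix_iff: "signed_perm_matrix A w \<longleftrightarrow> (\<exists>\<epsilon>. signed_perm_with A w \<epsilon>)"
  by (auto simp: signed_perm_matrix_def signed_perm_with_def)

lemma signed_perm_with_entry:
  assumes "signed_perm_with A w \<epsilon>"
  shows "A $ r $ c = (if r = w c then \<epsilon> c else 0)"
proof -
  have "A $ r $ c = (A *v std_basis c) $ r"
    unfolding matrix_vector_mult_basis by (simp add: column_def)
  also have "\<dots> = (\<epsilon> c *\<^sub>R std_basis (w c)) $ r"
    using assms by (simp add: signed_perm_with_def)
  finally show ?thesis by (simp add: axis_def)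
qed

lemma signed_perm_with_mult_nth:
  assumes "signed_perm_with A w \<epsilon>"
  shows "(A *v u) $ w x = \<epsilon> x * u $ x"
proof -
  have "w x = w c \<longleftrightarrow> x = c" for c
    using assms by (auto simp: signed_perm_with_def dest: bij_is_inj injD)
  then have "(A *v u) $ w x = (\<Sum>c\<in>UNIV. if x = c then \<epsilon> c * u $ c else 0)"
    unfolding matrix_vector_mult_def vec_lambda_beta signed_perm_with_entry[OF assms]
    by (intro sum.cong) auto
  then show ?thesis by simp
qed

lemma signed_perm_with_involution:
  fixes A :: "real^'n::finite^'n"
  assumes A: "signed_perm_with A w \<epsilon>" and "A ** A = mat 1"
  shows "w (w x) = x" and "\<epsilon> (w x) = \<epsilon> x"
proof -
  have "A *v (A *v std_basis x) = std_basis x"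
    using assms by (simp add: matrix_vector_mul_assoc)
  then have eq: "(\<epsilon> x * \<epsilon> (w x)) *\<^sub>R std_basis (w (w x)) = (std_basis x :: real^'n)"
    using A by (simp add: signed_perm_with_def matrix_vector_mult_scaleR)
  have sg: "\<epsilon> x \<in> {1, -1}" "\<epsilon> (w x) \<in> {1, -1}"
    using A by (auto simp: signed_perm_with_def)
  have "((\<epsilon> x * \<epsilon> (w x)) *\<^sub>R std_basis (w (w x))) $ x = (std_basis x :: real^'n) $ x"
    using eq by simp
  then have "w (w x) = x \<and> \<epsilon> x * \<epsilon> (w x) = 1"
    by (auto simp: axis_def split: if_splits)
  then show "w (w x) = x" "\<epsilon> (w x) = \<epsilon> x"
    using sg by auto
qed

text \<open>The signs are constant on the cycles of the involution \<open>w\<close>, so the entries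
  at \<open>(w c, c)\<close> and \<open>(c, w c)\<close> agree.\<close>

lemma signed_perm_with_symmetric:
  assumes "signed_perm_with A w \<epsilon>" and "A ** A = mat 1"
  shows "transpose A = A"
proof -
  have "A $ c $ r = A $ r $ c" for r c
    using signed_perm_with_involution[OF assms]
    by (auto simp: signed_perm_with_entry[OF assms(1)])
  then show ?thesis by (simp add: vec_eq_iff transpose_def)
qed

lemma signed_perm_with_trace:
  assumes "signed_perm_with A w \<epsilon>"
  shows "trace A = (\<Sum>x\<in>UNIV. if w x = x then \<epsilon> x else 0)"
  unfolding trace_def signed_perm_with_entry[OF assms] by (intro sum.cong) auto

section \<open>Triangular matrices\<close>

text \<open>The order is encoded by an injective height function, so that passing from \<open>h\<close> to \<open>- h\<close>
  exchanges upper and lower triangular matrices.\<close>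

definition triangular_pos :: "('n \<Rightarrow> int) \<Rightarrow> real^'n^'n \<Rightarrow> bool" where
  "triangular_pos h b \<longleftrightarrow> (\<forall>r c. h c < h r \<longrightarrow> b $ r $ c = 0) \<and> (\<forall>r. 0 < b $ r $ r)"

text \<open>Triangular matrices preserve the flag of subspaces cut out by bounds on the height of
  the support.\<close>

lemma triangular_pos_mult_zero:
  fixes u :: "real^'n::finite"
  assumes "triangular_pos h b" and "\<And>x. a < h x \<Longrightarrow> u $ x = 0" and "a < h x"
  shows "(b *v u) $ x = 0"
proof -
  have "b $ x $ c * u $ c = 0" for c
    using assms by (cases "a < h c") (auto simp: triangular_pos_def)
  then show ?thesis unfolding matrix_vector_mult_def vec_lambda_beta by (intro sum.neutral) blast
qed

text \<open>The leading coordinate meets only the diagonal entry, so a positive diagonal preserves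
  its sign.\<close>

lemma triangular_pos_mult_top:
  fixes u :: "real^'n::finite"
  assumes "inj h" and "triangular_pos h b" and "\<And>x. h l < h x \<Longrightarrow> u $ x = 0"
  shows "(b *v u) $ l = b $ l $ l * u $ l"
proof -
  have "b $ l $ c * u $ c = (if c = l then b $ l $ l * u $ l else 0)" for c
  proof (cases "c = l")
    case False
    then have "h c < h l \<or> h l < h c"
      using injD[OF assms(1), of c l] by linarith
    then show ?thesis
      using assms False by (auto simp: triangular_pos_def)
  qed simp
  then have "(b *v u) $ l = (\<Sum>c\<in>UNIV. if c = l then b $ l $ l * u $ l else 0)"
    unfolding matrix_vector_mult_def vec_lambda_beta by (intro sum.cong) blast+
  then show ?thesis by simp
qed

text \<open>If column \<open>x\<close> of \<open>c\<close> had a nonzero entry above height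
  \<open>h x\<close>, its highest one, in row \<open>m\<close>, would give \<open>b ** c\<close> the
  nonzero off-diagonal entry \<open>b $ m $ m * c $ m $ x\<close>.\<close>

lemma triangular_pos_inverse:
  fixes b c :: "real^'n::finite^'n"
  assumes h: "inj h" and b: "triangular_pos h b" and bc: "b ** c = mat 1"
  shows "triangular_pos h c"
proof -
  have col: "(b *v column x c) $ r = (if r = x then 1 else 0)" for x r
  proof -
    have "(b *v column x c) $ r = (b ** c) $ r $ x"
      by (simp add: matrix_vector_mult_def matrix_matrix_mult_def column_def)
    then show ?thesis by (simp add: bc mat_def)
  qed
  have zero: "c $ r $ x = 0" if "h x < h r" for r x
  proof (rule ccontr)
    assume nz: "c $ r $ x \<noteq> 0"
    define S where "S = h ` {y. c $ y $ x \<noteq> 0}"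
    have S: "finite S" "h r \<in> S" using nz by (auto simp: S_def)
    then have "Max S \<in> S" by (intro Max_in) auto
    then obtain m where m: "Max S = h m" "c $ m $ x \<noteq> 0" by (auto simp: S_def)
    have "h r \<le> h m" using S m(1) by (metis Max_ge)
    have "column x c $ y = 0" if "h m < h y" for y
    proof (rule ccontr)
      assume "column x c $ y \<noteq> 0"
      then have "h y \<in> S" by (auto simp: S_def column_def)
      then show False using Max_ge[OF S(1)] m(1) that by force
    qed
    then have "(b *v column x c) $ m = b $ m $ m * c $ m $ x"
      using triangular_pos_mult_top[OF h b, of m "column x c"] by (simp add: column_def)
    moreover have "m \<noteq> x" using \<open>h r \<le> h m\<close> that by auto
    ultimately have "b $ m $ m * c $ m $ x = 0" using col by simp
    moreover have "b $ m $ m > 0" using b by (simp add: triangular_pos_def)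
    ultimately show False using m(2) by simp
  qed
  have "0 < c $ r $ r" for r
  proof -
    have "b $ r $ r * c $ r $ r = 1"
      using triangular_pos_mult_top[OF h b, of r "column r c"] zero col by (simp add: column_def)
    moreover have "b $ r $ r > 0" using b by (simp add: triangular_pos_def)
    ultimately show ?thesis by (metis zero_less_mult_pos zero_less_one)
  qed
  with zero show ?thesis by (simp add: triangular_pos_def)
qed

lemma triangular_pos_transpose:
  assumes "triangular_pos h b"
  shows "triangular_pos (\<lambda>x. - h x) (transpose b)"
  using assms by (simp add: triangular_pos_def transpose_def)

lemma order_height_exists:
  obtains h :: "'n::{finite,linorder} \<Rightarrow> int" where "\<And>x y. h x < h y \<longleftrightarrow> x < y" "inj h"
proof -
  define h :: "'n \<Rightarrow> int" where "h x = int (card {y. y < x})" for x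
  have mono: "h x < h y" if "x < y" for x y
  proof -
    have "{z. z < x} \<subset> {z. z < y}" using that by auto
    then show ?thesis by (simp add: h_def psubset_card_mono)
  qed
  have "h x < h y \<longleftrightarrow> x < y" for x y
    using mono[of x y] mono[of y x] by (cases x y rule: linorder_cases) auto
  moreover have "inj h" using mono by (intro linorder_injI) fastforce
  ultimately show ?thesis using that by blast
qed

section \<open>Approximating basis vectors\<close>

lemma matrix_vector_mult_tendsto:
  fixes A :: "nat \<Rightarrow> real^'n::finite^'m::finite"
  assumes "A \<longlonglongrightarrow> B" and "u \<longlonglongrightarrow> z"
  shows "(\<lambda>n. A n *v u n) \<longlonglongrightarrow> B *v z"
  unfolding matrix_vector_mult_def
proof (rule vec_tendstoI)
  fix i
  have "(\<lambda>n. \<Sum>j\<in>UNIV. A n $ i $ j * u n $ j) \<longlonglongrightarrow> (\<Sum>j\<in>UNIV. B $ i $ j * z $ j)"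
    by (intro tendsto_sum tendsto_mult tendsto_vec_nth assms)
  then show "(\<lambda>n. (\<chi> i. \<Sum>j\<in>UNIV. A n $ i $ j * u n $ j) $ i) \<longlonglongrightarrow> (\<chi> i. \<Sum>j\<in>UNIV. B $ i $ j * z $ j) $ i"
    by simp
qed

text \<open>Compactness of the unit sphere supplies \<open>P\<close>. The images
  \<open>g n *v q n\<close> then tend, along the subsequence, to \<open>vt *v P\<close>, whose
  coordinate \<open>v x\<close> is \<open>P $ x\<close> up to sign. Hence \<open>P $ x\<close>
  vanishes once coordinate \<open>x\<close> of the vectors or coordinate \<open>v x\<close> of their
  images does.\<close>

lemma unit_vectors_limit:
  fixes h :: "'n::finite \<Rightarrow> int"
  assumes h: "inj h" and vt: "signed_perm_with vt v \<epsilon>"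
    and lim: "g \<longlonglongrightarrow> vt"
    and le: "\<And>y. v y = r \<Longrightarrow> h l \<le> h y"
    and unit: "\<And>n. norm (q n) = 1"
    and supp: "\<And>n x. h l < h x \<Longrightarrow> q n $ x = 0"
    and suppg: "\<And>n x. h r < h x \<Longrightarrow> (g n *v q n) $ x = 0"
    and kill: "\<And>n x. h x < h l \<Longrightarrow> h (v x) < h r \<Longrightarrow> (g n *v q n) $ v x = 0"
  obtains s P where "strict_mono (s :: nat \<Rightarrow> nat)" "(q \<circ> s) \<longlonglongrightarrow> P" "norm P = 1"
    "\<And>x. x \<noteq> l \<Longrightarrow> P $ x = 0"
proof -
  have "compact (sphere 0 1 :: (real^'n) set)" by simp
  then obtain P s where s: "strict_mono (s :: nat \<Rightarrow> nat)" and P: "(q \<circ> s) \<longlonglongrightarrow> P"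
      and "P \<in> sphere 0 1"
    using unit by (auto simp: compact_eq_seq_compact_metric elim!: seq_compactE[of _ q])
  then have "norm P = 1" by simp
  have gP: "(\<lambda>n. g (s n) *v q (s n)) \<longlonglongrightarrow> vt *v P"
    using matrix_vector_mult_tendsto[OF LIMSEQ_subseq_LIMSEQ[OF lim s] P] by (simp add: o_def)
  have "P $ x = 0" if "x \<noteq> l" for x
  proof -
    have nth: "(\<lambda>n. (g (s n) *v q (s n)) $ v x) \<longlonglongrightarrow> \<epsilon> x * P $ x"
      using tendsto_vec_nth[OF gP, of "v x"] by (simp add: signed_perm_with_mult_nth[OF vt])
    have "\<epsilon> x \<in> {1, -1}" using vt by (simp add: signed_perm_with_def)
    then have \<epsilon>: "\<epsilon> x \<noteq> 0" by auto
    have "h x \<noteq> h l" using h that by (auto dest: injD)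
    \<comment> \<open>For \<open>x\<close> below \<open>l\<close>, the index \<open>v x\<close> lies
      above \<open>r\<close> (support of the image), equals \<open>r\<close> (excluded by
      \<open>le\<close>) or lies below \<open>r\<close> (cleared by \<open>kill\<close>).\<close>
    then consider "h l < h x" | "h x < h l" "h r < h (v x)" | "h x < h l" "v x = r"
      | "h x < h l" "h (v x) < h r"
      using injD[OF h, of "v x" r] by linarith
    then show ?thesis
    proof cases
      case 1
      then have "(\<lambda>n. (q \<circ> s) n $ x) \<longlonglongrightarrow> 0" using supp by simp
      then show ?thesis using tendsto_vec_nth[OF P] LIMSEQ_unique by blast
    next
      case 2
      then have "(\<lambda>n. (g (s n) *v q (s n)) $ v x) \<longlonglongrightarrow> 0" using suppg by simp
      then have "\<epsilon> x * P $ x = 0" using nth LIMSEQ_unique by blast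
      then show ?thesis using \<epsilon> by simp
    next
      case 3
      then show ?thesis using le by force
    next
      case 4
      then have "(\<lambda>n. (g (s n) *v q (s n)) $ v x) \<longlonglongrightarrow> 0" using kill by simp
      then have "\<epsilon> x * P $ x = 0" using nth LIMSEQ_unique by blast
      then show ?thesis using \<epsilon> by simp
    qed
  qed
  with s P \<open>norm P = 1\<close> show ?thesis using that by blast
qed

lemma linear_image_eq_of_inj_dim_eq:
  fixes T :: "'a::euclidean_space \<Rightarrow> 'b::euclidean_space"
  assumes T: "linear T" and E: "subspace E" and F: "subspace F" and "T ` E \<subseteq> F"
    and dim: "dim F \<le> dim E" and inj: "\<And>u. u \<in> E \<Longrightarrow> T u = 0 \<Longrightarrow> u = 0"
  shows "T ` E = F"
proof -
  have "inj_on T E"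
    using inj by (simp add: linear_inj_on_iff_eq_0[OF T E])
  then have "dim (T ` E) = dim E"
    using dim_image_eq[OF T] span_eq_iff E by metis
  with assms show ?thesis
    by (intro subspace_dim_equal linear_subspace_image) auto
qed

text \<open>The factorization turns bounds on the supports of \<open>u\<close> and
  \<open>wt *v u\<close> into the same bounds for \<open>B' n *v u\<close> and its image under
  \<open>g n\<close>. Starting from \<open>u = std_basis l\<close>, a correction from
  \<open>E\<close> clears unwanted coordinates of the image; \<open>card\<close> says that there are
  as many parameters as conditions.\<close>

lemma approximating_vectors:
  fixes h :: "'n::finite \<Rightarrow> int" and g B B' :: "nat \<Rightarrow> real^'n^'n"
  assumes h: "inj h" and vt: "signed_perm_with vt v \<epsilon>" and wt: "signed_perm_with wt w \<delta>"
    and lim: "g \<longlonglongrightarrow> vt"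
    and fact: "\<And>n. g n ** B' n = B n ** wt"
    and B: "\<And>n. triangular_pos h (B n)" and B': "\<And>n. triangular_pos h (B' n)"
    and inv: "\<And>n. invertible (B' n)"
    and card: "card {x. h x < h l \<and> h (w x) < h (w l)} = card {x. h x < h l \<and> h (v x) < h (w l)}"
    and le: "\<And>y. v y = w l \<Longrightarrow> h l \<le> h y"
  obtains m p where "filterlim m at_top sequentially" "p \<longlonglongrightarrow> std_basis l"
    "\<And>n x. h l < h x \<Longrightarrow> p n $ x = 0"
    "\<And>n x. h (w l) < h x \<Longrightarrow> (g (m n) *v p n) $ x = 0"
    "\<And>n x. h x < h l \<Longrightarrow> h (v x) < h (w l) \<Longrightarrow> (g (m n) *v p n) $ v x = 0"
    "\<And>n. 0 < \<delta> l * (g (m n) *v p n) $ w l"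
proof -
  define X where "X = {x. h x < h l \<and> h (w x) < h (w l)}"
  define Y where "Y = {x. h x < h l \<and> h (v x) < h (w l)}"
  \<comment> \<open>\<open>E\<close> holds the corrections that leave the leading coordinates at
    \<open>l\<close> and \<open>w l\<close> unchanged; \<open>T n\<close> records the coordinates
    \<open>v y\<close> of the image, for \<open>y\<close> in \<open>Y\<close>, that have to be
    cleared.\<close>
  define E where "E = {u :: real^'n. \<forall>x. x \<notin> X \<longrightarrow> u $ x = 0}"
  define F where "F = {u :: real^'n. \<forall>x. x \<notin> Y \<longrightarrow> u $ x = 0}"
  define T where "T n u = (\<chi> y. if y \<in> Y then (g n *v (B' n *v u)) $ v y else 0)" for n u
  have E: "subspace E" and F: "subspace F"
    by (auto simp: E_def F_def subspace_def)
  have dims: "dim F = dim E"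
    using card unfolding E_def F_def dim_vec_eq[symmetric] dim_substandard_cart X_def Y_def by simp
  have linT: "linear (T n)" for n
    by (rule linearI)
      (auto simp: T_def vec_eq_iff matrix_vector_right_distrib matrix_vector_mult_scaleR)
  have TF: "T n u \<in> F" for n u
    by (simp add: T_def F_def)
  have gB: "g n *v (B' n *v u) = B n *v (wt *v u)" for n u
    by (simp add: matrix_vector_mul_assoc fact)
  have \<delta>: "\<delta> l * \<delta> l = 1"
  proof -
    have "\<delta> l \<in> {1, -1}" using wt by (simp add: signed_perm_with_def)
    then show ?thesis by auto
  qed
  have surjw: "\<exists>x. y = w x" for y
    using wt by (metis bij_pointE signed_perm_with_def)
  \<comment> \<open>Heights are integers, so the strict bound \<open>h x < h l\<close> is the weak
    bound by \<open>h l - 1\<close>.\<close>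
  have supp0: "(B' n *v u) $ x = 0" if "u \<in> E" "h l - 1 < h x" for n u x
    using triangular_pos_mult_zero[OF B' _ that(2)] that(1) by (auto simp: E_def X_def)
  have suppg0: "(g n *v (B' n *v u)) $ y = 0" if "u \<in> E" "h (w l) - 1 < h y" for n u y
    unfolding gB
  proof (rule triangular_pos_mult_zero[OF B _ that(2)])
    fix z assume z: "h (w l) - 1 < h z"
    obtain x where x: "z = w x" using surjw by blast
    then show "(wt *v u) $ z = 0"
      using that(1) z by (simp add: signed_perm_with_mult_nth[OF wt] E_def X_def)
  qed
  have nonzero: "B' n *v u \<noteq> 0" if "u \<noteq> 0" for n u
    using that injD[OF inj_matrix_vector_mult[OF inv], of n u 0] by auto
  \<comment> \<open>For large \<open>n\<close> the map \<open>T n\<close> is injective on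
    \<open>E\<close>: otherwise the normalized vectors \<open>B' n *v u\<close> with
    \<open>u\<close> in the kernel would have a unit limit concentrated at \<open>l\<close>,
    although their coordinate \<open>l\<close> is zero.\<close>
  have "\<exists>N. \<forall>n\<ge>N. \<forall>u\<in>E. T n u = 0 \<longrightarrow> u = 0"
  proof (rule ccontr)
    assume "\<not> ?thesis"
    then have "\<forall>N. \<exists>n u. N \<le> n \<and> u \<in> E \<and> T n u = 0 \<and> u \<noteq> 0" by blast
    then obtain m u where m: "\<And>N. N \<le> m N" and u: "\<And>N. u N \<in> E"
        and Tu: "\<And>N. T (m N) (u N) = 0" and nz: "\<And>N. u N \<noteq> 0"
      by metis
    define c where "c N = norm (B' (m N) *v u N)" for N
    define q where "q N = (1 / c N) *\<^sub>R (B' (m N) *v u N)" for N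
    have gq: "g (m N) *v q N = (1 / c N) *\<^sub>R (g (m N) *v (B' (m N) *v u N))" for N
      by (simp add: q_def matrix_vector_mult_scaleR)
    have "filterlim m at_top sequentially"
      by (rule filterlim_at_top_mono[OF filterlim_ident]) (simp add: m)
    then have lim': "(\<lambda>N. g (m N)) \<longlonglongrightarrow> vt"
      using filterlim_compose[OF lim] by blast
    have q1: "norm (q N) = 1" for N
      using nonzero[OF nz] by (simp add: q_def c_def)
    have q2: "q N $ x = 0" if "h l < h x" for N x
      using supp0[OF u] that by (simp add: q_def)
    have q3: "(g (m N) *v q N) $ x = 0" if "h (w l) < h x" for N x
      using suppg0[OF u] that by (simp add: gq)
    have q4: "(g (m N) *v q N) $ v x = 0" if "h x < h l" "h (v x) < h (w l)" for N x
      using arg_cong[OF Tu[of N], of "\<lambda>z. z $ x"] that by (simp add: gq T_def Y_def)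
    obtain s P where "strict_mono (s :: nat \<Rightarrow> nat)" and
        P: "(q \<circ> s) \<longlonglongrightarrow> P" "norm P = 1" "\<And>x. x \<noteq> l \<Longrightarrow> P $ x = 0"
      by (rule unit_vectors_limit[OF h vt lim' le q1 q2 q3 q4]) (assumption+, rule that)
    have "(q \<circ> s) n $ l = 0" for n
      using supp0[OF u] by (simp add: q_def)
    then have "P $ l = 0"
      using tendsto_vec_nth[OF P(1), of l] LIMSEQ_unique[OF _ tendsto_const] by force
    with P(3) have "P = 0" by (metis vec_eq_iff zero_index)
    with P(2) show False by simp
  qed
  then obtain N where N: "\<And>n u. N \<le> n \<Longrightarrow> u \<in> E \<Longrightarrow> T n u = 0 \<Longrightarrow> u = 0" by blast
  \<comment> \<open>Injectivity and equal dimensions make \<open>T (n + N)\<close> map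
    \<open>E\<close> onto \<open>F\<close>, so some correction matches the coordinates produced by
    \<open>std_basis l\<close>.\<close>
  have "\<exists>u\<in>E. T (n + N) u = T (n + N) (std_basis l)" for n
  proof -
    have "T (n + N) ` E = F"
      using N[of "n + N"] TF dims by (intro linear_image_eq_of_inj_dim_eq linT E F) auto
    then show ?thesis using TF by (metis imageE)
  qed
  then obtain u where u: "\<And>n. u n \<in> E" and Tu: "\<And>n. T (n + N) (u n) = T (n + N) (std_basis l)"
    by metis
  define a where "a n = std_basis l - u n" for n
  have al: "a n $ l = 1" for n
    using u[of n] by (simp add: a_def E_def X_def)
  define c where "c n = norm (B' (n + N) *v a n)" for n
  have c: "0 < c n" for n
  proof -
    have "a n \<noteq> 0" using al[of n] by (metis zero_index zero_neq_one)
    then show ?thesis using nonzero by (simp add: c_def)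
  qed
  define q where "q n = (1 / c n) *\<^sub>R (B' (n + N) *v a n)" for n
  have gq: "g (n + N) *v q n = (1 / c n) *\<^sub>R (g (n + N) *v (B' (n + N) *v a n))" for n
    by (simp add: q_def matrix_vector_mult_scaleR)
  have a0: "a n $ x = 0" if "h l < h x \<or> h (w l) < h (w x)" for n x
    using u[of n] that by (auto simp: a_def E_def X_def axis_def)
  have wa0: "(wt *v a n) $ y = 0" if y: "h (w l) < h y" for n y
  proof -
    obtain x where x: "y = w x" using surjw by blast
    then show ?thesis using a0 y by (simp add: signed_perm_with_mult_nth[OF wt])
  qed
  have q1: "norm (q n) = 1" for n
    using c[of n] by (simp add: q_def flip: c_def)
  have q2: "q n $ x = 0" if "h l < h x" for n x
    using triangular_pos_mult_zero[OF B' a0 that] by (simp add: q_def)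
  have q3: "(g (n + N) *v q n) $ x = 0" if "h (w l) < h x" for n x
    using triangular_pos_mult_zero[OF B wa0 that] by (simp add: gq gB)
  have q4: "(g (n + N) *v q n) $ v x = 0" if "h x < h l" "h (v x) < h (w l)" for n x
  proof -
    have "T (n + N) (a n) = 0"
      using Tu by (simp add: a_def linear_diff[OF linT])
    from arg_cong[OF this, of "\<lambda>z. z $ x"] that show ?thesis
      by (simp add: gq T_def Y_def)
  qed
  \<comment> \<open>This selects \<open>std_basis l\<close> rather than its negative as the
    limit.\<close>
  have q5: "0 < q n $ l" for n
  proof -
    have "(B' (n + N) *v a n) $ l = B' (n + N) $ l $ l"
      using triangular_pos_mult_top[OF h B', where l = l and u = "a n"] a0 al by simp
    then show ?thesis using c[of n] B'[of "n + N"] by (simp add: q_def triangular_pos_def)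
  qed
  have q6: "0 < \<delta> l * (g (n + N) *v q n) $ w l" for n
  proof -
    have "(B (n + N) *v (wt *v a n)) $ w l = B (n + N) $ w l $ w l * \<delta> l"
      using triangular_pos_mult_top[OF h B, where l = "w l" and u = "wt *v a n"] wa0 al
      by (simp add: signed_perm_with_mult_nth[OF wt])
    then have "\<delta> l * (g (n + N) *v q n) $ w l = B (n + N) $ w l $ w l / c n"
      using \<delta> by (simp add: gq gB)
    then show ?thesis using c[of n] B[of "n + N"] by (simp add: triangular_pos_def)
  qed
  obtain s P where s: "strict_mono s" and P: "(q \<circ> s) \<longlonglongrightarrow> P" "norm P = 1"
      "\<And>x. x \<noteq> l \<Longrightarrow> P $ x = 0"
    by (rule unit_vectors_limit[OF h vt LIMSEQ_ignore_initial_segment[OF lim] le q1 q2 q3 q4])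
      (assumption+, rule that)
  have "P = P $ l *\<^sub>R std_basis l"
    using P(3) by (auto simp: vec_eq_iff axis_def)
  then have "\<bar>P $ l\<bar> = 1"
    using P(2) by (metis mult.right_neutral norm_axis_1 norm_scaleR)
  moreover have "0 \<le> P $ l"
    using q5 by (intro LIMSEQ_le_const[OF tendsto_vec_nth[OF P(1)]]) (auto intro: less_imp_le)
  ultimately have "P = std_basis l"
    using \<open>P = P $ l *\<^sub>R std_basis l\<close> by simp
  moreover have "filterlim (\<lambda>n. s n + N) at_top sequentially"
    by (rule filterlim_at_top_mono[OF filterlim_subseq[OF s]]) simp
  ultimately show ?thesis
    using that[of "\<lambda>n. s n + N" "q \<circ> s"] P(1) q2 q3 q4 q6 by (simp add: o_def)
qed

text \<open>Moving \<open>b' n\<close> to the other side gives \<open>g n ** c n = b n ** wt\<close>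
  with \<open>c n\<close> the inverse of \<open>b' n\<close>, again upper triangular with positive
  diagonal.\<close>

lemma approximating_vectors_below:
  fixes vt wt :: "real^'n::{finite,linorder}^'n::{finite,linorder}"
  assumes vt: "signed_perm_with vt v \<epsilon>" and wt: "signed_perm_with wt w \<delta>"
    and lim: "g \<longlonglongrightarrow> vt"
    and fact: "\<And>n. g n = b n ** wt ** b' n"
    and b: "\<And>n. b n \<in> borel_pos" and b': "\<And>n. b' n \<in> borel_pos"
    and card: "card {x. x < l \<and> w x < w l} = card {x. x < l \<and> v x < w l}"
    and le: "\<And>y. v y = w l \<Longrightarrow> l \<le> y"
  obtains m p where "filterlim m at_top sequentially" "p \<longlonglongrightarrow> std_basis l"
    "\<And>n x. l < x \<Longrightarrow> p n $ x = 0"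
    "\<And>n x. w l < x \<Longrightarrow> (g (m n) *v p n) $ x = 0"
    "\<And>n x. x < l \<Longrightarrow> v x < w l \<Longrightarrow> (g (m n) *v p n) $ v x = 0"
    "\<And>n. 0 < \<delta> l * (g (m n) *v p n) $ w l"
proof -
  obtain h :: "'n \<Rightarrow> int" where h: "\<And>x y. h x < h y \<longleftrightarrow> x < y" "inj h"
    using order_height_exists by blast
  have le_h: "h x \<le> h y \<longleftrightarrow> x \<le> y" for x y
    using h(1) by (metis linorder_not_less)
  have "\<forall>n. \<exists>c. b' n ** c = mat 1 \<and> c ** b' n = mat 1"
    using b' by (simp add: borel_pos_def invertible_def)
  then obtain c where c: "\<And>n. b' n ** c n = mat 1" "\<And>n. c n ** b' n = mat 1" by metis
  have tri: "triangular_pos h (b n)" "triangular_pos h (b' n)" for n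
    using b b' by (simp_all add: borel_pos_def triangular_pos_def h(1))
  have eq: "g n ** c n = b n ** wt" for n
    by (metis c(1) fact matrix_mul_assoc matrix_mul_rid)
  have tri': "triangular_pos h (c n)" for n
    using triangular_pos_inverse[OF h(2) tri(2) c(1)] .
  have inv: "invertible (c n)" for n
    using c invertible_def by blast
  have card': "card {x. h x < h l \<and> h (w x) < h (w l)} = card {x. h x < h l \<and> h (v x) < h (w l)}"
    using card by (simp add: h(1))
  have le': "h l \<le> h y" if "v y = w l" for y
    using le[OF that] by (simp add: le_h)
  show ?thesis
    by (rule approximating_vectors[OF h(2) vt wt lim eq tri(1) tri' inv card' le', unfolded h(1)])
      (assumption, rule that)
qed

text \<open>As \<open>g n\<close> and \<open>wt\<close> are symmetric, transposing the factorization
  replaces the upper triangular factors by lower triangular ones. The height \<open>- h\<close> then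
  reverses every inequality, while the diagonals stay positive.\<close>

lemma approximating_vectors_above:
  fixes vt wt :: "real^'n::{finite,linorder}^'n::{finite,linorder}"
  assumes vt: "signed_perm_with vt v \<epsilon>" and wt: "signed_perm_with wt w \<delta>"
    and lim: "g \<longlonglongrightarrow> vt"
    and fact: "\<And>n. g n = b n ** wt ** b' n"
    and b: "\<And>n. b n \<in> borel_pos" and b': "\<And>n. b' n \<in> borel_pos"
    and sym: "\<And>n. transpose (g n) = g n" "transpose wt = wt"
    and card: "card {x. l < x \<and> w l < w x} = card {x. l < x \<and> w l < v x}"
    and le: "\<And>y. v y = w l \<Longrightarrow> y \<le> l"
  obtains m p where "filterlim m at_top sequentially" "p \<longlonglongrightarrow> std_basis l"
    "\<And>n x. x < l \<Longrightarrow> p n $ x = 0"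
    "\<And>n x. x < w l \<Longrightarrow> (g (m n) *v p n) $ x = 0"
    "\<And>n x. l < x \<Longrightarrow> w l < v x \<Longrightarrow> (g (m n) *v p n) $ v x = 0"
    "\<And>n. 0 < \<delta> l * (g (m n) *v p n) $ w l"
proof -
  obtain h :: "'n \<Rightarrow> int" where h: "\<And>x y. h x < h y \<longleftrightarrow> x < y" "inj h"
    using order_height_exists by blast
  have inj: "inj (\<lambda>x. - h x)"
    using h(2) by (simp add: inj_def)
  have le_h: "h x \<le> h y \<longleftrightarrow> x \<le> y" for x y
    using h(1) by (metis linorder_not_less)
  have "\<forall>n. \<exists>c. b n ** c = mat 1 \<and> c ** b n = mat 1"
    using b by (simp add: borel_pos_def invertible_def)
  then obtain c where c: "\<And>n. b n ** c n = mat 1" "\<And>n. c n ** b n = mat 1" by metis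
  have ct: "transpose (b n) ** transpose (c n) = mat 1" "transpose (c n) ** transpose (b n) = mat 1" for n
    using c by (metis matrix_transpose_mul transpose_mat)+
  have tri: "triangular_pos h (b n)" "triangular_pos h (b' n)" for n
    using b b' by (simp_all add: borel_pos_def triangular_pos_def h(1))
  have "g n = transpose (b' n) ** wt ** transpose (b n)" for n
    using sym fact[of n] by (metis matrix_mul_assoc matrix_transpose_mul)
  then have eq: "g n ** transpose (c n) = transpose (b' n) ** wt" for n
    by (metis ct(1) matrix_mul_assoc matrix_mul_rid)
  have tri': "triangular_pos (\<lambda>x. - h x) (transpose (c n))" for n
    using triangular_pos_inverse[OF inj triangular_pos_transpose[OF tri(1)] ct(1)] .
  have inv: "invertible (transpose (c n))" for n
    using ct invertible_def by blast
  have card': "card {x. - h x < - h l \<and> - h (w x) < - h (w l)} = card {x. - h x < - h l \<and> - h (v x) < - h (w l)}"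
    using card by (simp add: h(1))
  have le': "- h l \<le> - h y" if "v y = w l" for y
    using le[OF that] by (simp add: le_h)
  show ?thesis
    by (rule approximating_vectors[OF inj vt wt lim eq triangular_pos_transpose[OF tri(2)] tri' inv
          card' le', unfolded neg_less_iff_less h(1)])
      (assumption, rule that)
qed

section \<open>Sign relations for matrices in the closure of a cell\<close>

lemma eq_of_pos_limit:
  fixes a b :: real
  assumes "f \<longlonglongrightarrow> a" and "\<And>n. 0 < b * f n" and "a \<in> {1, -1}" and "b \<in> {1, -1}"
  shows "a = b"
proof -
  have "(\<lambda>n. b * f n) \<longlonglongrightarrow> b * a"
    by (intro tendsto_intros assms)
  then have "0 \<le> b * a"
    using assms(2) by (intro LIMSEQ_le_const) (auto intro: less_imp_le)
  then show ?thesis using assms(3,4) by auto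
qed

section \<open>A sequence in the cell of \<open>wt\<close> converging to \<open>vt\<close>\<close>

locale cell_limit =
  fixes vt wt :: "real^'n::{finite,linorder}^'n::{finite,linorder}"
    and v w :: "'n \<Rightarrow> 'n" and \<epsilon> \<delta> :: "'n \<Rightarrow> real"
    and g b b' :: "nat \<Rightarrow> real^'n::{finite,linorder}^'n::{finite,linorder}"
  assumes vt: "signed_perm_with vt v \<epsilon>" and wt: "signed_perm_with wt w \<delta>"
    and vt_inv: "vt ** vt = mat 1" and wt_inv: "wt ** wt = mat 1"
    and lim: "g \<longlonglongrightarrow> vt"
    and fact: "\<And>n. g n = b n ** wt ** b' n"
    and b: "\<And>n. b n \<in> borel_pos" and b': "\<And>n. b' n \<in> borel_pos"
    and orth: "\<And>n. orthogonal_matrix (g n)" and g_inv: "\<And>n. g n ** g n = mat 1"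
begin

lemma g_sym: "transpose (g n) = g n"
  using orth[of n] g_inv[of n] unfolding orthogonal_matrix
  by (metis matrix_mul_assoc matrix_mul_lid matrix_mul_rid)

lemma vv: "v (v x) = x" and \<epsilon>v: "\<epsilon> (v x) = \<epsilon> x"
  using signed_perm_with_involution[OF vt vt_inv] by auto

lemma ww: "w (w x) = x" and \<delta>w: "\<delta> (w x) = \<delta> x"
  using signed_perm_with_involution[OF wt wt_inv] by auto

lemma \<epsilon>_sign: "\<epsilon> x \<in> {1, -1}" and \<delta>_sign: "\<delta> x \<in> {1, -1}"
  using vt wt by (simp_all add: signed_perm_with_def)

lemma image_tendsto:
  assumes "filterlim m at_top sequentially" and "p \<longlonglongrightarrow> std_basis l"
  shows "(\<lambda>n. (g (m n) *v p n) $ v l) \<longlonglongrightarrow> \<epsilon> l"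
  using tendsto_vec_nth[OF matrix_vector_mult_tendsto[OF filterlim_compose[OF lim assms(1)] assms(2)], of "v l"]
  by (simp add: signed_perm_with_mult_nth[OF vt])

text \<open>If \<open>w l = v l\<close>, the coordinate that always has sign
  \<open>\<delta> l\<close> is the one that tends to \<open>\<epsilon> l\<close>.\<close>

lemma sign_eq:
  assumes "w l = v l" and "card {x. x < l \<and> w x < w l} = card {x. x < l \<and> v x < w l}"
  shows "\<epsilon> l = \<delta> l"
proof -
  have le: "l \<le> y" if "v y = w l" for y
    using that assms(1) vv by (metis order_refl)
  obtain m p where mp: "filterlim m at_top sequentially" "p \<longlonglongrightarrow> std_basis l"
    and pos: "\<And>n. 0 < \<delta> l * (g (m n) *v p n) $ w l"
    by (rule approximating_vectors_below[OF vt wt lim fact b b' assms(2) le]) (assumption, rule that)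
  then show ?thesis
    using eq_of_pos_limit[OF image_tendsto[OF mp]] \<epsilon>_sign \<delta>_sign assms(1) by simp
qed

text \<open>The vectors \<open>p\<close> near \<open>e\<^sub>i\<close> and \<open>q\<close> near \<open>e\<^sub>j\<close> have disjoint supports, so their images under
  the orthogonal \<open>g\<close> are perpendicular. Freeness of the rise leaves only the coordinates
  \<open>v i\<close> and \<open>v j\<close> in their inner product.\<close>

lemma sign_pair:
  assumes rise: "free_rise v i j" and wi: "w i = v j" and wj: "w j = v i"
    and below: "\<And>x. x < i \<Longrightarrow> w x = v x"
    and above: "\<And>x. j < x \<Longrightarrow> v i < w x \<longleftrightarrow> v i < v x"
  shows "\<delta> i * \<delta> j = - (\<epsilon> i * \<epsilon> j)"
proof -
  have ij: "i < j" "v i < v j"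
    and free: "\<And>x. i < x \<Longrightarrow> x < j \<Longrightarrow> v i < v x \<Longrightarrow> \<not> v x < v j"
    using rise by (auto simp: free_rise_def is_rise_def)
  have "{x. x < i \<and> w x < w i} = {x. x < i \<and> v x < w i}"
    using below by auto
  then have card_i: "card {x. x < i \<and> w x < w i} = card {x. x < i \<and> v x < w i}" by simp
  have le_i: "i \<le> y" if "v y = w i" for y
    using that wi ij vv by (metis less_imp_le)
  obtain m p where m: "filterlim m at_top sequentially" and p: "p \<longlonglongrightarrow> std_basis i"
    and p1: "\<And>n x. i < x \<Longrightarrow> p n $ x = 0"
    and p2: "\<And>n x. v j < x \<Longrightarrow> (g (m n) *v p n) $ x = 0"
    and p3: "\<And>n x. x < i \<Longrightarrow> v x < v j \<Longrightarrow> (g (m n) *v p n) $ v x = 0"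
    and p4: "\<And>n. 0 < \<delta> i * (g (m n) *v p n) $ v j"
    by (rule approximating_vectors_below[OF vt wt lim fact b b' card_i le_i, unfolded wi])
      (assumption, rule that)
  \<comment> \<open>The second family is built along \<open>g (m n)\<close>, so that
    \<open>p (m' n)\<close> and \<open>q n\<close> belong to the same matrix
    \<open>g (m (m' n))\<close>.\<close>
  have lim': "(\<lambda>n. g (m n)) \<longlonglongrightarrow> vt"
    using filterlim_compose[OF lim m] .
  have "{x. j < x \<and> w j < w x} = {x. j < x \<and> w j < v x}"
    using above wj by auto
  then have card_j: "card {x. j < x \<and> w j < w x} = card {x. j < x \<and> w j < v x}" by simp
  have le_j: "y \<le> j" if "v y = w j" for y
    using that wj ij vv by (metis less_imp_le)
  obtain m' q where m': "filterlim m' at_top sequentially" and q: "q \<longlonglongrightarrow> std_basis j"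
    and q1: "\<And>n x. x < j \<Longrightarrow> q n $ x = 0"
    and q2: "\<And>n x. x < v i \<Longrightarrow> (g (m (m' n)) *v q n) $ x = 0"
    and q3: "\<And>n x. j < x \<Longrightarrow> v i < v x \<Longrightarrow> (g (m (m' n)) *v q n) $ v x = 0"
    and q4: "\<And>n. 0 < \<delta> j * (g (m (m' n)) *v q n) $ v i"
    by (rule approximating_vectors_above[OF vt wt lim' fact b b' g_sym
          signed_perm_with_symmetric[OF wt wt_inv] card_j le_j, unfolded wj])
      (assumption, rule that)
  define P where "P n = g (m (m' n)) *v p (m' n)" for n
  define Q where "Q n = g (m (m' n)) *v q n" for n
  have PQ: "P n $ v i * Q n $ v i + P n $ v j * Q n $ v j = 0" for n
  proof -
    have zero: "P n $ x * Q n $ x = 0" if x: "x \<noteq> v i" "x \<noteq> v j" for x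
    proof -
      consider "v j < x" | "x < v i" | "v i < x" "x < v j" using x by (metis linorder_neqE)
      then show ?thesis
      proof cases
        case 3
        \<comment> \<open>Freeness, applied to the index \<open>v x\<close>, places it left of
          \<open>i\<close>, where \<open>p3\<close> clears coordinate \<open>x\<close> of
          \<open>P n\<close>, or right of \<open>j\<close>, where \<open>q3\<close> clears that of
          \<open>Q n\<close>.\<close>
        have "v x \<noteq> i" "v x \<noteq> j" using x vv by auto
        then have "v x < i \<or> j < v x"
          using free[of "v x"] 3 by (metis linorder_neqE vv)
        then show ?thesis
          using p3[of "v x" "m' n"] q3[of "v x" n] 3 by (auto simp: P_def Q_def vv)
      qed (simp_all add: P_def Q_def p2 q2)
    qed
    have "orthogonal_transformation ((*v) (g (m (m' n))))"
      using orth by (simp add: orthogonal_transformation_matrix)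
    then have "P n \<bullet> Q n = p (m' n) \<bullet> q n"
      by (simp add: P_def Q_def orthogonal_transformation_def)
    also have "\<dots> = 0"
      unfolding inner_vec_def
    proof (intro sum.neutral ballI)
      fix x show "p (m' n) $ x \<bullet> q n $ x = 0"
        using p1[of x] q1[of x] ij by (cases "i < x") auto
    qed
    finally have "0 = (\<Sum>x\<in>UNIV. P n $ x * Q n $ x)"
      by (simp add: inner_vec_def)
    also have "\<dots> = (\<Sum>x\<in>{v i, v j}. P n $ x * Q n $ x)"
      using zero by (intro sum.mono_neutral_right) auto
    finally show ?thesis using ij by simp
  qed
  have "(\<lambda>n. P n $ v i) \<longlonglongrightarrow> \<epsilon> i"
    unfolding P_def
    using image_tendsto[OF filterlim_compose[OF m m'] filterlim_compose[OF p m']] .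
  moreover have "(\<lambda>n. Q n $ v j) \<longlonglongrightarrow> \<epsilon> j"
    unfolding Q_def using image_tendsto[OF filterlim_compose[OF m m'] q] .
  ultimately have "(\<lambda>n. \<epsilon> i * P n $ v i) \<longlonglongrightarrow> \<epsilon> i * \<epsilon> i" "(\<lambda>n. \<epsilon> j * Q n $ v j) \<longlonglongrightarrow> \<epsilon> j * \<epsilon> j"
    by (auto intro: tendsto_mult_left)
  moreover have "\<epsilon> i * \<epsilon> i = 1" "\<epsilon> j * \<epsilon> j = 1"
    using \<epsilon>_sign[of i] \<epsilon>_sign[of j] by auto
  ultimately have "\<forall>\<^sub>F n in sequentially. 0 < \<epsilon> i * P n $ v i" "\<forall>\<^sub>F n in sequentially. 0 < \<epsilon> j * Q n $ v j"
    by (auto intro: order_tendstoD)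
  then have "\<forall>\<^sub>F n in sequentially. 0 < \<epsilon> i * P n $ v i \<and> 0 < \<epsilon> j * Q n $ v j"
    by eventually_elim simp
  then obtain n where n: "0 < \<epsilon> i * P n $ v i" "0 < \<epsilon> j * Q n $ v j"
    by (auto simp: eventually_sequentially)
  have d: "0 < \<delta> i * P n $ v j" "0 < \<delta> j * Q n $ v i"
    using p4[of "m' n"] q4[of n] by (simp_all add: P_def Q_def)
  \<comment> \<open>The two products in \<open>PQ\<close> have the signs of
    \<open>\<epsilon> i * \<delta> j\<close> and \<open>\<delta> i * \<epsilon> j\<close>. They sum
    to zero, so these signs are opposite.\<close>
  have "0 < (\<epsilon> i * P n $ v i) * (\<delta> j * Q n $ v i)" "0 < (\<delta> i * P n $ v j) * (\<epsilon> j * Q n $ v j)"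
    using n d by (simp_all only: mult_pos_pos)
  then have *: "0 < (\<epsilon> i * \<delta> j) * (P n $ v i * Q n $ v i)" "0 < (\<delta> i * \<epsilon> j) * (P n $ v j * Q n $ v j)"
    by (simp_all add: mult_ac)
  show ?thesis
    using * PQ[of n] \<epsilon>_sign[of i] \<epsilon>_sign[of j] \<delta>_sign[of i] \<delta>_sign[of j] by auto
qed

end

section \<open>Covering operations\<close>

lemma covering_op_outside:
  assumes "l \<notin> {i, j, v i, v j}"
  shows "covering_op v i j l = l"
  using assms by (simp add: covering_op_def transpose_def)

text \<open>Collecting the order of the indices and the values of the covering operation for each
  type spares later case distinctions from unfolding cycles.\<close>

lemma suitable_rise_cases:
  fixes v :: "'n::linorder \<Rightarrow> 'n"
  assumes vv: "\<And>x. v (v x) = x" and "suitable_rise v i j"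
  defines "\<sigma> \<equiv> covering_op v i j"
  obtains
    (ff) "rise_type v i j = (Ty_f, Ty_f)" "v i = i" "v j = j" "i < j" "\<sigma> i = j" "\<sigma> j = i"
  | (fe) "rise_type v i j = (Ty_f, Ty_e)" "v i = i" "i < j" "j < v j"
      "\<sigma> i = j" "\<sigma> j = v j" "\<sigma> (v j) = i"
  | (ef) "rise_type v i j = (Ty_e, Ty_f)" "v j = j" "i < v i" "v i < j"
      "\<sigma> i = j" "\<sigma> j = v i" "\<sigma> (v i) = i"
  | (nc) "rise_type v i j = (Ty_e, Ty_e)" "non_crossing v i j" "\<not> crossing v i j"
      "i < j" "j < v i" "v i < v j"
      "\<sigma> i = j" "\<sigma> j = i" "\<sigma> (v i) = v j" "\<sigma> (v j) = v i"
  | (cr) "rise_type v i j = (Ty_e, Ty_e)" "crossing v i j" "\<not> non_crossing v i j"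
      "i < v i" "v i < j" "j < v j"
      "\<sigma> i = j" "\<sigma> j = v j" "\<sigma> (v j) = v i" "\<sigma> (v i) = i"
  | (ed) "rise_type v i j = (Ty_e, Ty_d)" "i < v i" "v i < v j" "v j < j"
      "\<sigma> i = j" "\<sigma> j = i" "\<sigma> (v i) = v j" "\<sigma> (v j) = v i"
proof -
  have rise: "i < j" "v i < v j"
    using assms by (auto simp: suitable_rise_def free_rise_def is_rise_def)
  have "rise_type v i j \<in> {(Ty_f, Ty_f), (Ty_f, Ty_e), (Ty_e, Ty_f), (Ty_e, Ty_e), (Ty_e, Ty_d)}"
    using assms by (simp add: suitable_rise_def)
  then consider (1) "rise_type v i j = (Ty_f, Ty_f)" | (2) "rise_type v i j = (Ty_f, Ty_e)"
    | (3) "rise_type v i j = (Ty_e, Ty_f)" | (4) "rise_type v i j = (Ty_e, Ty_e)"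
    | (5) "rise_type v i j = (Ty_e, Ty_d)" by blast
  then show thesis
  proof cases
    case 1
    then have "v i = i" "v j = j"
      by (auto simp: rise_type_def index_type_def split: if_splits)
    then show thesis
      using 1 rise by (intro ff) (auto simp: \<sigma>_def covering_op_def)
  next
    case 2
    then have "v i = i" "j < v j"
      by (auto simp: rise_type_def index_type_def split: if_splits)
    then show thesis
      using 2 rise by (intro fe) (auto simp: \<sigma>_def covering_op_def transpose_def)
  next
    case 3
    then have "i < v i" "v j = j"
      by (auto simp: rise_type_def index_type_def split: if_splits)
    then show thesis
      using 3 rise by (intro ef) (auto simp: \<sigma>_def covering_op_def transpose_def)
  next
    case 4
    then have *: "i < v i" "j < v j"
      by (auto simp: rise_type_def index_type_def split: if_splits)
    \<comment> \<open>If \<open>v i = j\<close>, then \<open>v j = i < j\<close>, contrary to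
      \<open>j < v j\<close>.\<close>
    have "v i \<noteq> j" using * rise vv by (metis order_less_asym)
    then consider "v i < j" | "j < v i" by (metis linorder_neqE)
    then show thesis
    proof cases
      case 1
      then have "crossing v i j" "\<not> non_crossing v i j"
        using * by (auto simp: crossing_def non_crossing_def)
      then show thesis
        using 1 4 * rise by (intro cr) (auto simp: \<sigma>_def covering_op_def transpose_def)
    next
      case 2
      then have "\<not> crossing v i j" "non_crossing v i j"
        using * rise by (auto simp: crossing_def non_crossing_def)
      then show thesis
        using 2 4 * rise by (intro nc) (auto simp: \<sigma>_def covering_op_def transpose_def)
    qed
  next
    case 5
    then have "i < v i" "v j < j"
      by (auto simp: rise_type_def index_type_def split: if_splits)
    then show thesis
      using 5 rise by (intro ed) (auto simp: \<sigma>_def covering_op_def transpose_def)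
  qed
qed

lemma card_eq_of_sum_eq:
  fixes P Q :: "'a::finite \<Rightarrow> bool"
  assumes "\<And>x. x \<notin> K \<Longrightarrow> P x \<longleftrightarrow> Q x"
    and "(\<Sum>x\<in>K. of_bool (P x) :: nat) = (\<Sum>x\<in>K. of_bool (Q x))"
  shows "card {x. P x} = card {x. Q x}"
proof -
  have *: "card {x. R x} = (\<Sum>x\<in>K. of_bool (R x)) + (\<Sum>x\<in>- K. of_bool (R x) :: nat)" for R
    using sum.union_disjoint[of K "- K" "\<lambda>x. of_bool (R x) :: nat"] by simp
  have "(\<Sum>x\<in>- K. of_bool (P x) :: nat) = (\<Sum>x\<in>- K. of_bool (Q x))"
    using assms(1) by (intro sum.cong) auto
  then show ?thesis using assms(2) by (simp add: *)
qed

text \<open>Only the graph points over \<open>{i, j, v i, v j}\<close> move. Their count could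
  change only if \<open>(l, v l)\<close> or its mirror image \<open>(v l, l)\<close> lay in the
  rectangle spanned by the rise, which freeness forbids.\<close>

lemma covering_card_eq:
  fixes v :: "'n::{finite,linorder} \<Rightarrow> 'n"
  assumes vv: "\<And>x. v (v x) = x" and suit: "suitable_rise v i j"
    and w: "w = v \<circ> covering_op v i j" and l: "l \<notin> {i, j, v i, v j}"
  shows "card {x. x < l \<and> w x < v l} = card {x. x < l \<and> v x < v l}"
proof (rule card_eq_of_sum_eq[where K = "{i, j, v i, v j}"])
  show "x < l \<and> w x < v l \<longleftrightarrow> x < l \<and> v x < v l" if "x \<notin> {i, j, v i, v j}" for x
    using that by (simp add: w covering_op_outside)
next
  have free: "\<not> (i < x \<and> x < j \<and> v i < v x \<and> v x < v j)" for x
    using suit by (auto simp: suitable_rise_def free_rise_def)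
  have r: "v l \<noteq> i" "v l \<noteq> j" "v l \<noteq> v i" "v l \<noteq> v j" "l \<noteq> i" "l \<noteq> j" "l \<noteq> v i" "l \<noteq> v j"
    using l vv by (metis insertCI)+
  \<comment> \<open>Freeness for \<open>l\<close> and for \<open>v l\<close>; the inequalities
    \<open>r\<close> allow \<open>l < j\<close> to be written as the negation of
    \<open>j < l\<close>, so that only the atoms of the later case splits occur.\<close>
  have f: "\<not> (i < l \<and> \<not> j < l \<and> v i < v l \<and> \<not> v j < v l)"
    "\<not> (i < v l \<and> \<not> j < v l \<and> v i < l \<and> \<not> v j < l)"
    using free[of l] free[of "v l"] r by (auto simp: vv not_less_iff_gr_or_eq)
  \<comment> \<open>Transitivity as an implication: once instantiated along the chain of the four
    indices, it leaves purely propositional goals.\<close>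
  have mono: "y < z \<Longrightarrow> x < z" if "x < y" for x y z :: 'n
    using that by (rule less_trans)
  have sum4: "(\<Sum>x\<in>{i, j, v i, v j}. F x) = F i + F j + F (v i) + F (v j)"
    if "i \<noteq> j" "i \<noteq> v i" "i \<noteq> v j" "j \<noteq> v i" "j \<noteq> v j" "v i \<noteq> v j" for F :: "'n \<Rightarrow> nat"
    using that by simp
  show "(\<Sum>x\<in>{i, j, v i, v j}. of_bool (x < l \<and> w x < v l) :: nat) =
        (\<Sum>x\<in>{i, j, v i, v j}. of_bool (x < l \<and> v x < v l))"
    using vv suit
  proof (cases rule: suitable_rise_cases)
    case ff
    then have K: "{i, j, v i, v j} = {i, j}" and d: "i \<noteq> j" by auto
    show ?thesis
      unfolding K using ff f r d by (auto simp: w vv of_bool_def)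
  next
    case fe
    then have K: "{i, j, v i, v j} = {i, j, v j}" and d: "i \<noteq> v j" "i \<noteq> j" "j \<noteq> v j" by auto
    show ?thesis
      unfolding K using fe f r d by (auto simp: w vv of_bool_def)
  next
    case ef
    then have K: "{i, j, v i, v j} = {i, j, v i}" and d: "i \<noteq> v i" "i \<noteq> j" "j \<noteq> v i" by auto
    show ?thesis
      unfolding K using ef f r d by (auto simp: w vv of_bool_def)
  next
    case nc
    then have d: "i \<noteq> j" "i \<noteq> v i" "i \<noteq> v j" "j \<noteq> v i" "j \<noteq> v j" "v i \<noteq> v j" by auto
    show ?thesis
      using f
        mono[OF nc(4), of "l"] mono[OF nc(4), of "v l"] mono[OF nc(5), of "l"]
        mono[OF nc(5), of "v l"] mono[OF nc(6), of "l"] mono[OF nc(6), of "v l"]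
      by (simp only: sum4[OF d] w o_apply vv nc)
        (cases "i < l"; cases "j < l"; cases "v i < l"; cases "v j < l";
         cases "i < v l"; cases "j < v l"; cases "v i < v l"; cases "v j < v l"; simp)
  next
    case cr
    then have d: "i \<noteq> j" "i \<noteq> v i" "i \<noteq> v j" "j \<noteq> v i" "j \<noteq> v j" "v i \<noteq> v j" by auto
    show ?thesis
      using f
        mono[OF cr(4), of "l"] mono[OF cr(4), of "v l"] mono[OF cr(5), of "l"]
        mono[OF cr(5), of "v l"] mono[OF cr(6), of "l"] mono[OF cr(6), of "v l"]
      by (simp only: sum4[OF d] w o_apply vv cr)
        (cases "i < l"; cases "v i < l"; cases "j < l"; cases "v j < l";
         cases "i < v l"; cases "v i < v l"; cases "j < v l"; cases "v j < v l"; simp)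
  next
    case ed
    then have d: "i \<noteq> j" "i \<noteq> v i" "i \<noteq> v j" "j \<noteq> v i" "j \<noteq> v j" "v i \<noteq> v j" by auto
    show ?thesis
      using f
        mono[OF ed(2), of "l"] mono[OF ed(2), of "v l"] mono[OF ed(3), of "l"]
        mono[OF ed(3), of "v l"] mono[OF ed(4), of "l"] mono[OF ed(4), of "v l"]
      by (simp only: sum4[OF d] w o_apply vv ed)
        (cases "i < l"; cases "v i < l"; cases "v j < l"; cases "j < l";
         cases "i < v l"; cases "v i < v l"; cases "v j < v l"; cases "j < v l"; simp)
  qed
qed

section \<open>The sign of a covering operation\<close>

text \<open>The closure is relative to \<open>orth_involutions k\<close>, so \<open>vt\<close>
  itself lies there; this later supplies its trace.\<close>

lemma closure_of_cell_sequence: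
  assumes "vt \<in> top_of_set (orth_involutions k) closure_of bruhat_cell k wt"
  obtains g b b' where "vt \<in> orth_involutions k" "g \<longlonglongrightarrow> vt" "\<And>n. g n \<in> orth_involutions k"
    "\<And>n. g n = b n ** wt ** b' n" "\<And>n. b n \<in> borel_pos" "\<And>n. b' n \<in> borel_pos"
proof -
  have "vt \<in> orth_involutions k" "vt \<in> closure (bruhat_cell k wt)"
    using assms by (auto simp: closure_of_subtopology bruhat_cell_def)
  then obtain g where g: "\<And>n. g n \<in> bruhat_cell k wt" "g \<longlonglongrightarrow> vt"
    by (auto simp: closure_sequential)
  then have "\<forall>n. \<exists>c c'. g n = c ** wt ** c' \<and> c \<in> borel_pos \<and> c' \<in> borel_pos"
    by (auto simp: bruhat_cell_def)
  then obtain b b' where "\<And>n. g n = b n ** wt ** b' n \<and> b n \<in> borel_pos \<and> b' n \<in> borel_pos"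
    by metis
  moreover have "g n \<in> orth_involutions k" for n
    using g(1)[of n] by (simp add: bruhat_cell_def)
  ultimately show ?thesis
    using that \<open>vt \<in> orth_involutions k\<close> g(2) by metis
qed

lemma matrix_eq_std_basis:
  fixes A B :: "real^'n::finite^'m::finite"
  assumes "\<And>l. A *v std_basis l = B *v std_basis l"
  shows "A = B"
  using assms by (simp add: matrix_vector_mult_basis column_def vec_eq_iff)

context cell_limit
begin

section \<open>Sign relations for a fixed suitable rise\<close>

context
  fixes i j :: 'n
  assumes suit: "suitable_rise v i j" and w: "w = v \<circ> covering_op v i j"
begin

lemma w_outside: "l \<notin> {i, j, v i, v j} \<Longrightarrow> w l = v l"
  by (simp add: w covering_op_outside)

lemma sign_outside:
  assumes "l \<notin> {i, j, v i, v j}"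
  shows "\<epsilon> l = \<delta> l"
  using sign_eq[OF w_outside[OF assms]] covering_card_eq[OF vv suit w assms] w_outside[OF assms]
  by simp

text \<open>Outside the four indices \<open>v\<close> and \<open>w\<close> have the same fixed
  points with the same signs, so these contributions to the traces cancel.\<close>

lemma trace_local:
  assumes "trace vt = trace wt"
  shows "(\<Sum>x\<in>{i, j, v i, v j}. if v x = x then \<epsilon> x else 0) =
         (\<Sum>x\<in>{i, j, v i, v j}. if w x = x then \<delta> x else 0)" (is "sum ?f ?K = sum ?g ?K")
proof -
  have "sum ?f (- ?K) = sum ?g (- ?K)"
    using w_outside sign_outside by (intro sum.cong) auto
  moreover have "sum F UNIV = sum F ?K + sum F (- ?K)" for F :: "'n \<Rightarrow> real"
    using sum.union_disjoint[of ?K "- ?K" F] by simp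
  ultimately show ?thesis
    using assms by (simp only: signed_perm_with_trace[OF vt] signed_perm_with_trace[OF wt])
qed

text \<open>The covering operation exchanges \<open>i\<close> and \<open>j\<close> exactly for the
  types \<open>ff\<close>, non-crossing \<open>ee\<close> and \<open>ed\<close>.\<close>

lemma sign_pair_swap:
  assumes swap: "covering_op v i j j = i"
  shows "\<delta> i * \<delta> j = - (\<epsilon> i * \<epsilon> j)"
proof -
  have ij: "i < j" and free: "free_rise v i j"
    using suit by (auto simp: suitable_rise_def free_rise_def is_rise_def)
  have wi: "w i = v j" and below: "i \<le> v i" "i \<le> v j"
    \<comment> \<open>The second alternative is non-crossing \<open>ee\<close>: for \<open>x\<close>
      equal to \<open>v i\<close> or \<open>v j\<close>, both \<open>w x\<close> and
      \<open>v x\<close> are at most \<open>v i\<close>, so both sides of the required equivalence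
      fail. In the first, neither index exceeds \<open>j\<close>.\<close>
    and above: "v i \<le> j \<and> v j \<le> j \<or> w (v i) \<le> v i \<and> w (v j) \<le> v i \<and> j \<le> v i"
    using vv suit by (cases rule: suitable_rise_cases; use swap in \<open>auto simp: w vv\<close>)+
  show ?thesis
  proof (rule sign_pair[OF free wi])
    show "w j = v i" by (simp add: w swap)
    show "w x = v x" if "x < i" for x
      using that below ij by (intro w_outside) auto
    show "v i < w x \<longleftrightarrow> v i < v x" if "j < x" for x
    proof (cases "x \<in> {v i, v j}")
      case True
      then show ?thesis using that above below ij by (auto simp: vv)
    next
      case False
      then have "w x = v x" using that ij by (intro w_outside) auto
      then show ?thesis by simp
    qed
  qed
qed

end

end

theorem theorem4p3:
  fixes vt wt :: "real^'n::{finite,linorder}^'n::{finite,linorder}"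
    and v w :: "'n \<Rightarrow> 'n"
    and i j :: 'n
    and k :: nat
  assumes "signed_perm_matrix vt v" and "signed_perm_matrix wt w"
    and "vt ** vt = mat 1" and "wt ** wt = mat 1"
    and "trace wt = real CARD('n) - 2 * real k"
    and "vt \<in> top_of_set (orth_involutions k) closure_of bruhat_cell k wt"
    and "int (cell_dim v) = int (cell_dim w) - 1"
    and "suitable_rise v i j"
    and "w = v \<circ> covering_op v i j"
  shows "\<exists>D. sign_diagonal_matrix D \<and>
    wt = vt ** perm_matrix (covering_op v i j) ** D \<and>
    perm_matrix (covering_op v i j) ** D = vt ** wt \<and>
    (let \<sigma> = (\<lambda>l. (perm_matrix (covering_op v i j) ** D) *v std_basis l) in
      (\<forall>l. l \<notin> {i, j, v i, v j} \<longrightarrow> \<sigma> l = std_basis l) \<and>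
      (\<exists>\<alpha>\<in>{1, -1}. \<exists>\<beta>\<in>{1, -1}. \<exists>\<gamma>\<in>{1, -1}.
        (rise_type v i j = (Ty_f, Ty_f) \<longrightarrow>
          \<sigma> i = \<alpha> *\<^sub>R std_basis j \<and> \<sigma> j = (- \<alpha>) *\<^sub>R std_basis i) \<and>
        (rise_type v i j = (Ty_f, Ty_e) \<longrightarrow>
          \<sigma> i = \<beta> *\<^sub>R std_basis j \<and> \<sigma> j = \<alpha> *\<^sub>R std_basis (v j) \<and>
          \<sigma> (v j) = (\<alpha> * \<beta>) *\<^sub>R std_basis i) \<and>
        (rise_type v i j = (Ty_e, Ty_f) \<longrightarrow>
          \<sigma> i = \<alpha> *\<^sub>R std_basis j \<and> \<sigma> j = \<beta> *\<^sub>R std_basis (v i) \<and>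
          \<sigma> (v i) = (\<alpha> * \<beta>) *\<^sub>R std_basis i) \<and>
        (rise_type v i j = (Ty_e, Ty_e) \<and> non_crossing v i j \<longrightarrow>
          \<sigma> i = \<beta> *\<^sub>R std_basis j \<and> \<sigma> j = (- \<beta>) *\<^sub>R std_basis i \<and>
          \<sigma> (v i) = \<alpha> *\<^sub>R std_basis (v j) \<and> \<sigma> (v j) = (- \<alpha>) *\<^sub>R std_basis (v i)) \<and>
        (rise_type v i j = (Ty_e, Ty_e) \<and> crossing v i j \<longrightarrow>
          \<sigma> i = \<gamma> *\<^sub>R std_basis j \<and> \<sigma> j = \<alpha> *\<^sub>R std_basis (v j) \<and>
          \<sigma> (v j) = \<beta> *\<^sub>R std_basis (v i) \<and>
          \<sigma> (v i) = (- (\<alpha> * \<beta> * \<gamma>)) *\<^sub>R std_basis i) \<and>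
        (rise_type v i j = (Ty_e, Ty_d) \<longrightarrow>
          \<sigma> i = \<alpha> *\<^sub>R std_basis j \<and> \<sigma> j = (- \<alpha>) *\<^sub>R std_basis i \<and>
          \<sigma> (v i) = \<beta> *\<^sub>R std_basis (v j) \<and> \<sigma> (v j) = (- \<beta>) *\<^sub>R std_basis (v i))))"
proof -
  obtain \<epsilon> \<delta> where signs: "signed_perm_with vt v \<epsilon>" "signed_perm_with wt w \<delta>"
    using assms(1,2) by (auto simp: signed_perm_matrix_iff)
  obtain g b b' where vtk: "vt \<in> orth_involutions k" and "g \<longlonglongrightarrow> vt"
    and gk: "\<And>n. g n \<in> orth_involutions k" and "\<And>n. g n = b n ** wt ** b' n"
    and "\<And>n. b n \<in> borel_pos" "\<And>n. b' n \<in> borel_pos"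
    by (rule closure_of_cell_sequence[OF assms(6)]) (rule that)
  then interpret cell_limit vt wt v w \<epsilon> \<delta> g b b'
    using signs assms(3,4) by unfold_locales (auto simp: orth_involutions_def)
  note suit = assms(8) and w = assms(9)
  define c where "c = covering_op v i j"
  \<comment> \<open>Comparing \<open>wt\<close> with \<open>vt ** perm_matrix c ** D\<close> on
    \<open>std_basis l\<close> forces \<open>\<delta> l = \<epsilon> (c l) * s l\<close>.\<close>
  define s where "s l = \<delta> l * \<epsilon> (c l)" for l
  define D where "D = (\<chi> x y. if x = y then s x else 0)"
  have wc: "w l = v (c l)" for l
    by (simp add: w c_def)
  have s_sign: "s l \<in> {1, -1}" for l
    using \<epsilon>_sign[of "c l"] \<delta>_sign[of l] by (auto simp: s_def)
  have D: "sign_diagonal_matrix D"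
    using s_sign by (simp add: sign_diagonal_matrix_def D_def)
  have "D *v std_basis l = s l *\<^sub>R std_basis l" for l
    unfolding matrix_vector_mult_basis by (simp add: vec_eq_iff D_def column_def axis_def)
  then have sig: "(perm_matrix c ** D) *v std_basis l = s l *\<^sub>R std_basis (c l)" for l
    by (simp add: matrix_vector_mult_scaleR perm_matrix_std_basis flip: matrix_vector_mul_assoc)
  have "(vt ** wt) *v std_basis l = s l *\<^sub>R std_basis (c l)" for l
    using signs unfolding signed_perm_with_def
    by (simp add: matrix_vector_mult_scaleR s_def wc vv \<epsilon>v flip: matrix_vector_mul_assoc)
  then have prod: "perm_matrix c ** D = vt ** wt"
    using sig by (intro matrix_eq_std_basis) simp
  then have wt_eq: "wt = vt ** perm_matrix c ** D"
    by (metis assms(3) matrix_mul_assoc matrix_mul_lid)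
  have outside: "s l *\<^sub>R std_basis (c l) = std_basis l" if "l \<notin> {i, j, v i, v j}" for l
    using that sign_outside[OF suit w that] \<delta>_sign[of l] by (auto simp: s_def c_def covering_op_outside)
  have "trace vt = trace wt"
    using vtk assms(5) by (simp add: orth_involutions_def)
  note tr = trace_local[OF suit w this]
  note sgn = \<epsilon>_sign[of i] \<epsilon>_sign[of j] \<delta>_sign[of i] \<delta>_sign[of j]
  \<comment> \<open>All witnesses are values of \<open>s\<close>, hence signs; a parameter absent
    from the type at hand receives the dummy value \<open>s i\<close>.\<close>
  have ex: "\<exists>\<alpha>\<in>{1, -1}. \<exists>\<beta>\<in>{1, -1}. \<exists>\<gamma>\<in>{1, -1}. R \<alpha> \<beta> \<gamma>"
    if "R (s x) (s y) (s z)" for R :: "real \<Rightarrow> real \<Rightarrow> real \<Rightarrow> bool" and x y z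
    using that s_sign by blast
  show ?thesis
    using vv suit
  proof (cases rule: suitable_rise_cases)
    case ff
    then have c: "c i = j" "c j = i" by (simp_all add: c_def)
    have "\<delta> i * \<delta> j = - (\<epsilon> i * \<epsilon> j)"
      using sign_pair_swap[OF suit w] ff by simp
    then have "s j = - s i" using sgn by (auto simp: s_def c)
    then show ?thesis
      unfolding c_def[symmetric] Let_def
      by (intro exI[of _ D] conjI D wt_eq prod ex[of _ i i i]) (simp_all add: sig outside ff c)
  next
    case fe
    then have c: "c i = j" "c j = v j" "c (v j) = i" by (simp_all add: c_def)
    have K: "{i, j, v i, v j} = {i, j, v j}" and "i \<noteq> j" "i \<noteq> v j" "j \<noteq> v j" using fe by auto
    \<comment> \<open>Among these indices \<open>v\<close> fixes only \<open>i\<close> and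
      \<open>w\<close> fixes only \<open>j\<close>.\<close>
    then have "\<epsilon> i = \<delta> j"
      using tr fe unfolding K by (simp add: wc c vv)
    moreover have "\<delta> (v j) = \<delta> i" using \<delta>w[of i] by (simp add: wc c)
    ultimately have "s (v j) = s j * s i" using sgn by (auto simp: s_def c \<epsilon>v)
    then show ?thesis
      unfolding c_def[symmetric] Let_def
      by (intro exI[of _ D] conjI D wt_eq prod ex[of _ j i i]) (simp_all add: sig outside fe c)
  next
    case ef
    then have c: "c i = j" "c j = v i" "c (v i) = i" by (simp_all add: c_def)
    have K: "{i, j, v i, v j} = {i, j, v i}" and "i \<noteq> j" "i \<noteq> v i" "j \<noteq> v i" using ef by auto
    \<comment> \<open>Here \<open>v\<close> fixes only \<open>j\<close> and \<open>w\<close> fixes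
      only \<open>v i\<close>.\<close>
    then have "\<epsilon> j = \<delta> (v i)"
      using tr ef unfolding K by (simp add: wc c vv)
    moreover have "\<delta> j = \<delta> i" using \<delta>w[of i] ef by (simp add: wc c)
    ultimately have "s (v i) = s i * s j" using sgn by (auto simp: s_def c \<epsilon>v)
    then show ?thesis
      unfolding c_def[symmetric] Let_def
      by (intro exI[of _ D] conjI D wt_eq prod ex[of _ i j i]) (simp_all add: sig outside ef c)
  next
    case nc
    then have c: "c i = j" "c j = i" "c (v i) = v j" "c (v j) = v i" by (simp_all add: c_def)
    have "\<delta> i * \<delta> j = - (\<epsilon> i * \<epsilon> j)"
      using sign_pair_swap[OF suit w] nc by simp
    \<comment> \<open>The involution \<open>w\<close> exchanges \<open>i\<close> with
      \<open>v j\<close> and \<open>j\<close> with \<open>v i\<close>, so the single relation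
      settles both pairs of signs.\<close>
    moreover have "\<delta> (v j) = \<delta> i" "\<delta> (v i) = \<delta> j" using \<delta>w[of i] \<delta>w[of j] by (simp_all add: wc c)
    ultimately have "s j = - s i" "s (v j) = - s (v i)"
      using sgn by (auto simp: s_def c \<epsilon>v)
    then show ?thesis
      unfolding c_def[symmetric] Let_def
      by (intro exI[of _ D] conjI D wt_eq prod ex[of _ "v i" i i]) (simp_all add: sig outside nc c)
  next
    case cr
    then have c: "c i = j" "c j = v j" "c (v j) = v i" "c (v i) = i" by (simp_all add: c_def)
    have "i \<noteq> j" "i \<noteq> v i" "i \<noteq> v j" "j \<noteq> v i" "j \<noteq> v j" "v i \<noteq> v j" using cr by auto
    \<comment> \<open>Here \<open>v\<close> fixes none of the four indices and \<open>w\<close>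
      fixes \<open>j\<close> and \<open>v i\<close>, so their signs must cancel in the
      trace.\<close>
    then have "\<delta> (v i) = - \<delta> j"
      using tr cr by (simp add: wc c vv)
    moreover have "\<delta> (v j) = \<delta> i" using \<delta>w[of i] by (simp add: wc c)
    ultimately have "s (v i) = - (s j * s (v j) * s i)" using sgn by (auto simp: s_def c \<epsilon>v)
    then show ?thesis
      unfolding c_def[symmetric] Let_def
      by (intro exI[of _ D] conjI D wt_eq prod ex[of _ j "v j" i]) (simp_all add: sig outside cr c)
  next
    case ed
    then have c: "c i = j" "c j = i" "c (v i) = v j" "c (v j) = v i" by (simp_all add: c_def)
    have "\<delta> i * \<delta> j = - (\<epsilon> i * \<epsilon> j)"
      using sign_pair_swap[OF suit w] ed by simp
    moreover have "\<delta> (v j) = \<delta> i" "\<delta> (v i) = \<delta> j" using \<delta>w[of i] \<delta>w[of j] by (simp_all add: wc c)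
    ultimately have "s j = - s i" "s (v j) = - s (v i)"
      using sgn by (auto simp: s_def c \<epsilon>v)
    then show ?thesis
      unfolding c_def[symmetric] Let_def
      by (intro exI[of _ D] conjI D wt_eq prod ex[of _ i "v i" i]) (simp_all add: sig outside ed c)
  qed
qed

end
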